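(* Let $m\ge 2$ be an even integer, and let $n=a_0+a_1m+\cdots+a_km^k$ be the base-$m$ representation of $n$ ($a_j\in\{0,\ldots,m-1\}$). Then \[ p_m(n,-1)=(-1)^{a_0}\prod_{j=1}^{k}\frac{1+(-1)^{a_j}}{2}. \] In particular $p_m(n,-1)\in\{-1,0,1\}$, and $p_m(n,-1)=0$ if and only if $a_j$ is odd for some $j\in\{1,\ldots,k\}$.
   Context: The $m$-ary partition polynomials $p_m(n,t)$ are defined by the power series expansion $\prod_{j=0}^{\infty}\frac{1}{1-tq^{m^j}}=\sum_{n=0}^{\infty}p_m(n,t)q^n$. An empty product equals $1$. *)

theory Defs
  imports "HOL-Analysis.Analysis" "HOL-Computational_Algebra.Formal_Power_Series"
    "HOL-Computational_Algebra.Polynomial"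
begin

text \<open>
  The factor \<open>1 / (1 - t q^(m^j))\<close> as a formal power series in \<open>q\<close> over \<open>\<int>[t]\<close>; here \<open>[:0, 1:]\<close>
  is the indeterminate \<open>t\<close>. The type class operation \<open>inverse\<close> is not available, since \<open>\<int>[t]\<close> is
  not a field, but \<open>fps_right_inverse\<close> only needs an inverse of the constant coefficient, which
  is \<open>1\<close>.
\<close>

definition mary_factor :: "nat \<Rightarrow> nat \<Rightarrow> int poly fps" where
  "mary_factor m j = fps_right_inverse (1 - fps_const [:0, 1:] * fps_X ^ (m ^ j)) 1"

text \<open>
  The infinite product is taken with respect to the standard \<open>q\<close>-adic metric on formal power
  series; it converges for \<open>m \<ge> 2\<close>, see \<open>mary_factor_has_prod\<close> below.
\<close>

definition mary_partition_poly :: "nat \<Rightarrow> nat \<Rightarrow> int poly" where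
  "mary_partition_poly m n = fps_nth (prodinf (\<lambda>j. mary_factor m j)) n"

lemma mary_factor_inverse:
  assumes "m \<ge> 1"
  shows "(1 - fps_const [:0, 1:] * fps_X ^ (m ^ j)) * mary_factor m j = 1"
  unfolding mary_factor_def
  by (rule fps_right_inverse) (use assms in simp)

lemma mary_factor_unfold:
  assumes "m \<ge> 1"
  shows "mary_factor m j = 1 + fps_X ^ (m ^ j) * (fps_const [:0, 1:] * mary_factor m j)"
proof -
  have "mary_factor m j - fps_const [:0, 1:] * fps_X ^ (m ^ j) * mary_factor m j = 1"
    using mary_factor_inverse[OF assms, of j] by (simp only: left_diff_distrib mult_1_left)
  then have "mary_factor m j = 1 + fps_const [:0, 1:] * fps_X ^ (m ^ j) * mary_factor m j"
    by (rule iffD1[OF diff_eq_eq])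
  also have "\<dots> = 1 + fps_X ^ (m ^ j) * (fps_const [:0, 1:] * mary_factor m j)"
    by (simp only: mult.assoc mult.left_commute)
  finally show ?thesis .
qed

lemma mary_prod_nth:
  assumes "m \<ge> 2" "i \<le> n"
  shows "fps_nth (\<Prod>j\<le>n. mary_factor m j) i = fps_nth (\<Prod>j\<le>i. mary_factor m j) i"
  using assms(2)
proof (induction n rule: dec_induct)
  case (step n)
  have "Suc n < m ^ Suc n"
    using assms(1) by (intro power_gt_expt) auto
  then have lt: "i < m ^ Suc n"
    using step.hyps by linarith
  let ?P = "\<Prod>j\<le>n. mary_factor m j"
  have "(\<Prod>j\<le>Suc n. mary_factor m j) = ?P * mary_factor m (Suc n)"
    by simp
  also have "\<dots> = ?P * (1 + fps_X ^ (m ^ Suc n) * (fps_const [:0, 1:] * mary_factor m (Suc n)))"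
    using assms(1) by (intro arg_cong[where f = "(*) ?P"] mary_factor_unfold) simp
  also have "\<dots> = ?P + fps_X ^ (m ^ Suc n) * (?P * (fps_const [:0, 1:] * mary_factor m (Suc n)))"
    by (simp only: distrib_left mult_1_right mult.left_commute)
  finally have "fps_nth (\<Prod>j\<le>Suc n. mary_factor m j) i = fps_nth ?P i"
    using lt by (simp add: fps_X_power_mult_nth del: power_Suc)
  then show ?case
    using step.IH by simp
qed simp

lemma mary_factor_has_prod:
  assumes "m \<ge> 2"
  shows "(\<lambda>j. mary_factor m j) has_prod Abs_fps (\<lambda>i. fps_nth (\<Prod>j\<le>i. mary_factor m j) i)"
    (is "_ has_prod ?L")
proof -
  have "(\<lambda>n. \<Prod>j\<le>n. mary_factor m j) \<longlonglongrightarrow> ?L"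
  proof (rule tendsto_fpsI)
    fix i
    show "\<forall>\<^sub>F n in sequentially. fps_nth (\<Prod>j\<le>n. mary_factor m j) i = fps_nth ?L i"
      using eventually_ge_at_top[of i]
      by eventually_elim (simp only: fps_nth_Abs_fps, rule mary_prod_nth[OF assms])
  qed
  moreover have "fps_nth ?L 0 = 1"
    by (simp add: mary_factor_def)
  then have "?L \<noteq> 0"
    by (metis fps_zero_nth zero_neq_one)
  ultimately show ?thesis
    by (simp add: has_prod_def raw_has_prod_def)
qed

end

theory Submission
  imports Defs "HOL-Computational_Algebra.Formal_Laurent_Series"
begin

text \<open>
  The product satisfies \<open>(1 - t q) F(q) = F(q^m)\<close>. At \<open>t = -1\<close> and with \<open>c n = p_m(n,-1)\<close> this reads
  \<open>c n + c (n - 1) = c (n / m)\<close> if \<open>m\<close> divides \<open>n\<close>, and \<open>= 0\<close> otherwise. Hence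
  \<open>c (m N + r) = (-1)^r c (m N)\<close> for \<open>r < m\<close>, and, since \<open>m\<close> is even,
  \<open>c (m (N + 1)) = c (m N) + c (N + 1)\<close>. The latter telescopes to \<open>c (m N) = c 0 + \<dots> + c N\<close>, in
  which every complete block of length \<open>m\<close> cancels, so that \<open>c (m (m M + r))\<close> equals \<open>c (m M)\<close> for
  even \<open>r\<close> and \<open>0\<close> for odd \<open>r\<close>. Iterating over the digits gives the product formula.
\<close>

text \<open>Substituting \<open>q^m\<close> for \<open>q\<close> turns the equation defining the
  factor \<open>j\<close> into the one defining the factor \<open>Suc j\<close>; inverses are unique
  because the ring has no zero divisors.\<close>

lemma mary_factor_compose:
  assumes "m \<ge> 1"
  shows "mary_factor m j oo fps_X ^ m = mary_factor m (Suc j)"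
proof -
  have m0: "fps_nth (fps_X ^ m :: int poly fps) 0 = 0"
    using assms by simp
  let ?g = "\<lambda>j. 1 - fps_const [:0, 1:] * fps_X ^ (m ^ j) :: int poly fps"
  have "?g j oo fps_X ^ m = ?g (Suc j)"
    using assms
    by (simp add: fps_compose_sub_distrib fps_compose_mult_distrib[OF m0] fps_X_power_compose
        flip: power_mult)
  moreover have "(?g j oo fps_X ^ m) * (mary_factor m j oo fps_X ^ m) = 1"
    by (simp only: fps_compose_mult_distrib[OF m0, symmetric] mary_factor_inverse[OF assms]
        fps_compose_1)
  ultimately have "?g (Suc j) * (mary_factor m j oo fps_X ^ m) = ?g (Suc j) * mary_factor m (Suc j)"
    by (simp only: mary_factor_inverse[OF assms])
  moreover have "?g (Suc j) \<noteq> 0"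
    using mary_factor_inverse[OF assms, of "Suc j"] by (metis mult_zero_left zero_neq_one)
  ultimately show ?thesis
    by (simp only: mult_cancel_left simp_thms)
qed

lemma mary_partition_poly_eq_nth_prod:
  assumes "m \<ge> 2" "n \<le> N"
  shows "mary_partition_poly m n = fps_nth (\<Prod>j\<le>N. mary_factor m j) n"
  using has_prod_unique[OF mary_factor_has_prod[OF assms(1)], symmetric] mary_prod_nth[OF assms]
  by (simp add: mary_partition_poly_def)

lemma mary_partition_poly_0:
  assumes "m \<ge> 2"
  shows "mary_partition_poly m 0 = 1"
  using mary_partition_poly_eq_nth_prod[OF assms, of 0 0] by (simp add: mary_factor_def)

lemma mary_partition_poly_Suc:
  assumes "m \<ge> 2"
  shows "mary_partition_poly m (Suc n) = [:0, 1:] * mary_partition_poly m n +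
           (if m dvd Suc n then mary_partition_poly m (Suc n div m) else 0)"
proof -
  define P where "P N = (\<Prod>j\<le>N. mary_factor m j)" for N
  have m: "m \<ge> 1" and m0: "fps_nth (fps_X ^ m :: int poly fps) 0 = 0"
    using assms by simp_all
  \<comment> \<open>Splitting off the factor \<open>0\<close> costs one index, so this bound leaves
    \<open>P (Suc n)\<close>, still exact up to the coefficient \<open>Suc n\<close>.\<close>
  have "P (Suc (Suc n)) = mary_factor m 0 * (\<Prod>j\<le>Suc n. mary_factor m (Suc j))"
    unfolding P_def by (rule prod.atMost_Suc_shift)
  also have "(\<Prod>j\<le>Suc n. mary_factor m (Suc j)) = P (Suc n) oo fps_X ^ m"
    by (simp only: P_def fps_compose_prod_distrib[OF m0] mary_factor_compose[OF m])
  finally have "(1 - fps_const [:0, 1:] * fps_X ^ (m ^ 0)) * P (Suc (Suc n)) = P (Suc n) oo fps_X ^ m"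
    by (simp only: mult.assoc[symmetric] mary_factor_inverse[OF m] mult_1_left)
  then have "fps_nth (P (Suc (Suc n)) - fps_const [:0, 1:] * (fps_X * P (Suc (Suc n)))) (Suc n)
      = fps_nth (P (Suc n) oo fps_X ^ m) (Suc n)"
    by (simp only: left_diff_distrib mult.assoc mult_1_left power_0 power_one_right)
  then have "fps_nth (P (Suc (Suc n))) (Suc n) - [:0, 1:] * fps_nth (P (Suc (Suc n))) n
      = (if m dvd Suc n then fps_nth (P (Suc n)) (Suc n div m) else 0)"
    using m by (simp only: fps_sub_nth fps_mult_left_const_nth fps_X_mult_nth
        fps_nth_compose_X_power) simp
  moreover have "fps_nth (P N) i = mary_partition_poly m i" if "i \<le> N" for i N
    using mary_partition_poly_eq_nth_prod[OF assms that] by (simp only: P_def)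
  moreover have "Suc n div m \<le> Suc n"
    by simp
  ultimately show ?thesis
    by (simp add: diff_eq_eq add.commute split: if_splits)
qed

context
  fixes m :: nat and c :: "nat \<Rightarrow> int"
  assumes m_ge_2: "m \<ge> 2" and even_m: "even m"
  defines "c \<equiv> \<lambda>n. poly (mary_partition_poly m n) (-1)"
begin

lemma eval_0: "c 0 = 1"
  by (simp add: c_def mary_partition_poly_0[OF m_ge_2])

lemma eval_Suc: "c (Suc n) = (if m dvd Suc n then c (Suc n div m) else 0) - c n"
  by (simp add: c_def mary_partition_poly_Suc[OF m_ge_2])

text \<open>Strictly between multiples of \<open>m\<close> the recurrence only flips the
  sign.\<close>

lemma eval_mult_add:
  assumes "r < m"
  shows "c (m * N + r) = (-1) ^ r * c (m * N)"
  using assms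
proof (induction r)
  case (Suc r)
  have "\<not> m dvd Suc (m * N + r)"
    using Suc.prems
    by (metis add_Suc_right dvd_add_right_iff dvd_triv_left nat_dvd_not_less zero_less_Suc)
  then show ?case
    using Suc eval_Suc[of "m * N + r"] by simp
qed simp

lemma eval_mult_Suc: "c (m * Suc N) = c (m * N) + c (Suc N)"
proof -
  have eq: "m * Suc N = Suc (m * N + (m - 1))"
    using m_ge_2 by simp
  \<comment> \<open>Here evenness of \<open>m\<close> enters: \<open>m - 1\<close> is odd.\<close>
  have "c (m * N + (m - 1)) = - c (m * N)"
    using eval_mult_add[of "m - 1" N] m_ge_2 even_m by simp
  moreover have "c (m * Suc N) = c (Suc N) - c (m * N + (m - 1))"
    using eval_Suc[of "m * N + (m - 1)", folded eq] m_ge_2 by simp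
  ultimately show ?thesis
    by simp
qed

text \<open>The increments within a block are \<open>c (m * M)\<close> with alternating signs. The
  case \<open>r = 0\<close> is assumed, since its proof by induction on \<open>M\<close> needs this
  lemma for the preceding block.\<close>

lemma eval_mult_digit_step:
  assumes "r < m" and "c (m * (m * M)) = c (m * M)"
  shows "c (m * (m * M + r)) = (if even r then c (m * M) else 0)"
  using assms(1)
proof (induction r)
  case (Suc r)
  then show ?case
    using eval_mult_Suc[of "m * M + r"] eval_mult_add[of "Suc r" M] by simp
qed (use assms(2) in simp)

text \<open>Each block ends at the odd digit \<open>m - 1\<close> with value \<open>0\<close>, so
  the next value equals its increment \<open>c (m * Suc M)\<close>.\<close>

lemma eval_mult_mult: "c (m * (m * M)) = c (m * M)"
proof (induction M)
  case (Suc M)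
  have eq: "m * Suc M = Suc (m * M + (m - 1))"
    using m_ge_2 by simp
  have "c (m * (m * M + (m - 1))) = 0"
    using eval_mult_digit_step[OF _ Suc, of "m - 1"] m_ge_2 even_m by simp
  then show ?case
    using eval_mult_Suc[of "m * M + (m - 1)", folded eq] by simp
qed simp

text \<open>The outer factor \<open>m\<close> makes every \<open>a j\<close> a digit of positive
  position; the units digit contributes a sign instead and is treated separately.\<close>

lemma eval_mult_digits:
  assumes "\<And>j. j < k \<Longrightarrow> a j < m"
  shows "c (m * (\<Sum>j<k. a j * m ^ j)) = (\<Prod>j<k. if even (a j) then 1 else 0)"
  using assms
proof (induction k arbitrary: a)
  case (Suc k)
  let ?M = "\<Sum>j<k. a (Suc j) * m ^ j"
  have "(\<Sum>j<Suc k. a j * m ^ j) = m * ?M + a 0"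
    by (simp add: sum.lessThan_Suc_shift sum_distrib_left mult_ac del: sum.lessThan_Suc)
  then have "c (m * (\<Sum>j<Suc k. a j * m ^ j)) = (if even (a 0) then c (m * ?M) else 0)"
    using eval_mult_digit_step[OF _ eval_mult_mult, of "a 0"] Suc.prems by simp
  also have "c (m * ?M) = (\<Prod>j<k. if even (a (Suc j)) then 1 else 0)"
    using Suc.prems by (intro Suc.IH) simp
  finally show ?case
    by (simp add: prod.lessThan_Suc_shift del: prod.lessThan_Suc)
qed (simp add: eval_0)

lemma eval_digits:
  assumes "\<And>j. j \<le> k \<Longrightarrow> a j < m"
  shows "c (\<Sum>j=0..k. a j * m ^ j) = (-1) ^ a 0 * (\<Prod>j=1..k. if even (a j) then 1 else 0)"
proof -
  have "(\<Sum>j=0..k. a j * m ^ j) = m * (\<Sum>j<k. a (Suc j) * m ^ j) + a 0"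
    by (simp add: atLeast0AtMost sum.atMost_shift sum_distrib_left mult_ac)
  moreover have "(\<Prod>j=1..k. if even (a j) then 1 else 0 :: int)
      = (\<Prod>j<k. if even (a (Suc j)) then 1 else 0)"
    by (simp add: prod.atLeast1_atMost_eq)
  ultimately show ?thesis
    using assms by (simp add: eval_mult_add eval_mult_digits[of k "\<lambda>j. a (Suc j)"])
qed

end

theorem theorem3p3:
  fixes m n k :: nat and a :: "nat \<Rightarrow> nat"
  assumes "m \<ge> 2" and "even m"
    and "\<forall>j\<le>k. a j \<in> {0..m - 1}"
    and "n = (\<Sum>j=0..k. a j * m ^ j)"
  shows "rat_of_int (poly (mary_partition_poly m n) (-1))
           = (-1) ^ a 0 * (\<Prod>j=1..k. (1 + (-1) ^ a j) / 2)
    \<and> poly (mary_partition_poly m n) (-1) \<in> {-1, 0, 1}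
    \<and> (poly (mary_partition_poly m n) (-1) = 0 \<longleftrightarrow> (\<exists>j\<in>{1..k}. odd (a j)))"
proof -
  let ?Q = "\<Prod>j=1..k. if even (a j) then 1 else 0 :: int"
  have "a j < m" if "j \<le> k" for j
    using assms(1,3) that by fastforce
  then have value_eq: "poly (mary_partition_poly m n) (-1) = (-1) ^ a 0 * ?Q"
    unfolding assms(4) by (rule eval_digits[OF assms(1,2)])
  have "rat_of_int ?Q = (\<Prod>j=1..k. (1 + (-1) ^ a j) / 2)"
    unfolding of_int_prod by (rule prod.cong) auto
  moreover have "?Q = (if \<exists>j\<in>{1..k}. odd (a j) then 0 else 1)"
    by simp
  moreover have "(-1) ^ a 0 \<in> {-1, 1 :: int}"
    by (cases "even (a 0)") simp_all
  ultimately show ?thesis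
    unfolding value_eq by (cases "\<exists>j\<in>{1..k}. odd (a j)") simp_all
qed

end
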